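(* The scalar product induces a bijection between equivalence classes of tame $SL_2(\mathbb{Z}[\sigma])$-tilings and pairs of bi-infinite paths in $\mathcal{T}$ considered up to the simultaneous action of $SL_2(\mathbb{Z}[\sigma])$ by $A$ on the first path and by $(A^T)^{-1}$ on the second path ($A\in SL_2(\mathbb{Z}[\sigma])$). Here a pair of paths $(u_i),(v_j)$ is sent to the equivalence class of the tiling $(p_ir_j+q_is_j)_{i,j\in\mathbb{Z}}$, where $u_i=p_i/q_i$ and $v_j=r_j/s_j$ are any normalisations of the two paths.
   Context: Let $\sigma=e^{i\pi/3}$, $\mathbb{Z}[\sigma]$ the Eisenstein integers, $\widehat{\mathbb{Q}}(\sigma)=\mathbb{Q}(\sigma)\cup\{\infty\}$. A fraction $p/q$ ($p,q\in\mathbb{Z}[\sigma]$, not both zero) is irreducible if every common factor $k\in\mathbb{Z}[\sigma]$ of $p,q$ has $|k|=1$. $\mathcal{T}$ is the graph with vertex set $\widehat{\mathbb{Q}}(\sigma)$ in which points with irreducible representations $p/q$, $r/s$ are adjacent iff $|ps-rq|=1$. A bi-infinite path is a sequence $(v_i)_{i\in\mathbb{Z}}$ of vertices with $v_i,v_{i+1}$ adjacent; a normalisation of it is a choice of irreducible fractions $v_i=p_i/q_i$ with $p_iq_{i+1}-p_{i+1}q_i=1$ for all $i$ (any path has exactly six normalisations, differing by multiplying $p_i,q_i$ by $\sigma^{(-1)^ik}$). $SL_2(\mathbb{Z}[\sigma])$ acts on $\widehat{\mathbb{Q}}(\sigma)$ by Möbius transformations $z\mapsto\frac{az+b}{cz+d}$,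 preserving $\mathcal{T}$, hence acts on paths. A bi-infinite matrix $(m_{i,j})$ over $\mathbb{Z}[\sigma]$ is an $SL_2(\mathbb{Z}[\sigma])$-tiling if $m_{i,j}m_{i+1,j+1}-m_{i,j+1}m_{i+1,j}=1$ for all $i,j$, and tame if all $3\times3$ determinants $\det(m_{i+a,j+b})_{a,b=0,1,2}$ vanish. Two tilings $(m_{i,j})$, $(m'_{i,j})$ are equivalent if there are integers $k,l$ with $m'_{i,j}=\sigma^{(-1)^ik+(-1)^jl}m_{i,j}$ for all $i,j$. *)

theory Defs
  imports "HOL-Analysis.Analysis"
begin

definition \<sigma> :: complex where
  "\<sigma> = exp (\<i> * of_real (pi / 3))"

definition eisenstein :: "complex set" where
  "eisenstein = {of_int a + of_int b * \<sigma> | a b :: int. True}"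

definition eisenstein_field :: "complex set" where
  "eisenstein_field = {of_rat a + of_rat b * \<sigma> | a b :: rat. True}"

(* The point at infinity is None; a finite point z is Some z. *)
definition vertices :: "complex option set" where
  "vertices = insert None (Some ` eisenstein_field)"

definition fraction :: "complex \<Rightarrow> complex \<Rightarrow> complex option" where
  "fraction p q = (if q = 0 then None else Some (p / q))"

definition irreducible_fraction :: "complex \<Rightarrow> complex \<Rightarrow> bool" where
  "irreducible_fraction p q \<longleftrightarrow>
     p \<in> eisenstein \<and> q \<in> eisenstein \<and> \<not> (p = 0 \<and> q = 0) \<and>
     (\<forall>k\<in>eisenstein. (\<exists>a\<in>eisenstein. p = k * a) \<and> (\<exists>b\<in>eisenstein. q = k * b) \<longrightarrow> cmod k = 1)"

definition adjacent :: "complex option \<Rightarrow> complex option \<Rightarrow> bool" where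
  "adjacent x y \<longleftrightarrow>
     (\<exists>p q r s. irreducible_fraction p q \<and> x = fraction p q \<and>
                irreducible_fraction r s \<and> y = fraction r s \<and> cmod (p * s - r * q) = 1)"

definition paths :: "(int \<Rightarrow> complex option) set" where
  "paths = {v. \<forall>i. v i \<in> vertices \<and> adjacent (v i) (v (i + 1))}"

definition normalisation ::
    "(int \<Rightarrow> complex option) \<Rightarrow> (int \<Rightarrow> complex) \<Rightarrow> (int \<Rightarrow> complex) \<Rightarrow> bool" where
  "normalisation v p q \<longleftrightarrow>
     (\<forall>i. irreducible_fraction (p i) (q i) \<and> v i = fraction (p i) (q i) \<and>
          p i * q (i + 1) - p (i + 1) * q i = 1)"

definition SL2 :: "(complex^2^2) set" where
  "SL2 = {A. (\<forall>i j. A $ i $ j \<in> eisenstein) \<and> det A = 1}"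

fun moebius_action :: "complex^2^2 \<Rightarrow> complex option \<Rightarrow> complex option" where
  "moebius_action A None = fraction (A $ 1 $ 1) (A $ 2 $ 1)"
| "moebius_action A (Some z) = fraction (A $ 1 $ 1 * z + A $ 1 $ 2) (A $ 2 $ 1 * z + A $ 2 $ 2)"

definition path_pair_equiv ::
    "(((int \<Rightarrow> complex option) \<times> (int \<Rightarrow> complex option)) \<times>
      ((int \<Rightarrow> complex option) \<times> (int \<Rightarrow> complex option))) set" where
  "path_pair_equiv =
     {((u, v), (u', v')).
        u \<in> paths \<and> v \<in> paths \<and> u' \<in> paths \<and> v' \<in> paths \<and>
        (\<exists>A\<in>SL2. (\<forall>i. u' i = moebius_action A (u i)) \<and>
                 (\<forall>j. v' j = moebius_action (matrix_inv (transpose A)) (v j)))}"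

definition SL2_tiling :: "(int \<Rightarrow> int \<Rightarrow> complex) \<Rightarrow> bool" where
  "SL2_tiling m \<longleftrightarrow>
     (\<forall>i j. m i j \<in> eisenstein) \<and>
     (\<forall>i j. m i j * m (i + 1) (j + 1) - m i (j + 1) * m (i + 1) j = 1)"

definition tame :: "(int \<Rightarrow> int \<Rightarrow> complex) \<Rightarrow> bool" where
  "tame m \<longleftrightarrow>
     (\<forall>i j. det (vector
        [vector [m i j, m i (j + 1), m i (j + 2)],
         vector [m (i + 1) j, m (i + 1) (j + 1), m (i + 1) (j + 2)],
         vector [m (i + 2) j, m (i + 2) (j + 1), m (i + 2) (j + 2)]] :: complex^3^3) = 0)"

definition tame_tilings :: "(int \<Rightarrow> int \<Rightarrow> complex) set" where
  "tame_tilings = {m. SL2_tiling m \<and> tame m}"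

definition tiling_equiv :: "((int \<Rightarrow> int \<Rightarrow> complex) \<times> (int \<Rightarrow> int \<Rightarrow> complex)) set" where
  "tiling_equiv =
     {(m, m'). m \<in> tame_tilings \<and> m' \<in> tame_tilings \<and>
        (\<exists>k l :: int. \<forall>i j.
           m' i j = \<sigma> powi ((-1) ^ nat \<bar>i\<bar> * k + (-1) ^ nat \<bar>j\<bar> * l) * m i j)}"

definition scalar_product_tiling ::
    "(int \<Rightarrow> complex) \<Rightarrow> (int \<Rightarrow> complex) \<Rightarrow> (int \<Rightarrow> complex) \<Rightarrow> (int \<Rightarrow> complex) \<Rightarrow> int \<Rightarrow> int \<Rightarrow> complex" where
  "scalar_product_tiling p q r s = (\<lambda>i j. p i * r j + q i * s j)"

(* The map on classes of pairs of paths. It is the union of the tiling classes obtained from all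
   representatives and all normalisations, so its value is a single tiling class only if at least
   one such class exists and all of them coincide. *)
definition scalar_product_map ::
    "((int \<Rightarrow> complex option) \<times> (int \<Rightarrow> complex option)) set \<Rightarrow> (int \<Rightarrow> int \<Rightarrow> complex) set" where
  "scalar_product_map X =
     \<Union> {tiling_equiv `` {scalar_product_tiling p q r s} | p q r s.
          \<exists>(u, v)\<in>X. normalisation u p q \<and> normalisation v r s}"

lemma sigma_nonzero: "\<sigma> \<noteq> 0"
  by (simp add: \<sigma>_def)

lemma equiv_tiling_equiv: "equiv tame_tilings tiling_equiv"
proof (rule equivI)
  show "tiling_equiv \<subseteq> tame_tilings \<times> tame_tilings"
    by (auto simp: tiling_equiv_def)
  show "refl_on tame_tilings tiling_equiv"
    unfolding refl_on_def tiling_equiv_def by (auto intro!: exI[of _ 0])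
  show "sym tiling_equiv"
  proof (rule symI)
    fix m m' assume "(m, m') \<in> tiling_equiv"
    then obtain k l where mm: "m \<in> tame_tilings" "m' \<in> tame_tilings"
      and kl: "\<And>i j. m' i j = \<sigma> powi ((-1) ^ nat \<bar>i\<bar> * k + (-1) ^ nat \<bar>j\<bar> * l) * m i j"
      by (auto simp: tiling_equiv_def)
    have "m i j = \<sigma> powi ((-1) ^ nat \<bar>i\<bar> * (-k) + (-1) ^ nat \<bar>j\<bar> * (-l)) * m' i j" for i j
    proof -
      have "(-1) ^ nat \<bar>i\<bar> * (-k) + (-1) ^ nat \<bar>j\<bar> * (-l) = - ((-1) ^ nat \<bar>i\<bar> * k + (-1) ^ nat \<bar>j\<bar> * l)"
        by simp
      then show ?thesis
        using sigma_nonzero by (simp only: kl power_int_minus) (simp add: field_simps)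
    qed
    with mm show "(m', m) \<in> tiling_equiv"
      unfolding tiling_equiv_def by blast
  qed
  show "trans tiling_equiv"
  proof (rule transI)
    fix m m' m'' assume "(m, m') \<in> tiling_equiv" "(m', m'') \<in> tiling_equiv"
    then obtain k l k' l' where mm: "m \<in> tame_tilings" "m'' \<in> tame_tilings"
      and kl: "\<And>i j. m' i j = \<sigma> powi ((-1) ^ nat \<bar>i\<bar> * k + (-1) ^ nat \<bar>j\<bar> * l) * m i j"
      and kl': "\<And>i j. m'' i j = \<sigma> powi ((-1) ^ nat \<bar>i\<bar> * k' + (-1) ^ nat \<bar>j\<bar> * l') * m' i j"
      unfolding tiling_equiv_def by blast
    have "m'' i j = \<sigma> powi ((-1) ^ nat \<bar>i\<bar> * (k + k') + (-1) ^ nat \<bar>j\<bar> * (l + l')) * m i j" for i j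
    proof -
      have "(-1) ^ nat \<bar>i\<bar> * (k + k') + (-1) ^ nat \<bar>j\<bar> * (l + l') =
          ((-1) ^ nat \<bar>i\<bar> * k' + (-1) ^ nat \<bar>j\<bar> * l') + ((-1) ^ nat \<bar>i\<bar> * k + (-1) ^ nat \<bar>j\<bar> * l)"
        by (simp add: algebra_simps)
      then show ?thesis
        using sigma_nonzero by (simp only: kl kl' power_int_add simp_thms) (simp add: mult_ac)
    qed
    with mm show "(m, m'') \<in> tiling_equiv"
      unfolding tiling_equiv_def by blast
  qed
qed

lemma sigma_squared: "\<sigma> * \<sigma> = \<sigma> - 1"
proof -
  have "\<sigma> = Complex (1 / 2) (sqrt 3 / 2)"
    by (simp add: \<sigma>_def exp_eq_polar cis.ctr cos_60 sin_60 flip: cis_conv_exp)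
  then have re_im: "Re \<sigma> = 1 / 2" "Im \<sigma> = sqrt 3 / 2" by (metis complex.sel)+
  show ?thesis
    unfolding complex_eq_iff times_complex.sel minus_complex.sel one_complex.sel re_im by simp
qed

lemma eisenstein_uminus: "x \<in> eisenstein \<Longrightarrow> - x \<in> eisenstein"
proof -
  assume "x \<in> eisenstein"
  then obtain a b where "x = of_int a + of_int b * \<sigma>" by (auto simp: eisenstein_def)
  then have "- x = of_int (-a) + of_int (-b) * \<sigma>" by simp
  then show ?thesis unfolding eisenstein_def by blast
qed

lemma eisenstein_add: "x \<in> eisenstein \<Longrightarrow> y \<in> eisenstein \<Longrightarrow> x + y \<in> eisenstein"
proof -
  assume "x \<in> eisenstein" "y \<in> eisenstein"
  then obtain a b c d where "x = of_int a + of_int b * \<sigma>" "y = of_int c + of_int d * \<sigma>"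
    by (auto simp: eisenstein_def)
  then have "x + y = of_int (a + c) + of_int (b + d) * \<sigma>" by (simp add: algebra_simps)
  then show ?thesis unfolding eisenstein_def by blast
qed

lemma eisenstein_mult: "x \<in> eisenstein \<Longrightarrow> y \<in> eisenstein \<Longrightarrow> x * y \<in> eisenstein"
proof -
  assume "x \<in> eisenstein" "y \<in> eisenstein"
  then obtain a b c d where "x = of_int a + of_int b * \<sigma>" "y = of_int c + of_int d * \<sigma>"
    by (auto simp: eisenstein_def)
  then have "x * y = of_int a * of_int c + (of_int a * of_int d + of_int b * of_int c) * \<sigma>
      + of_int b * of_int d * (\<sigma> * \<sigma>)"
    by (simp add: algebra_simps)
  also have "\<dots> = of_int (a * c - b * d) + of_int (a * d + b * c + b * d) * \<sigma>"
    by (simp add: sigma_squared algebra_simps)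
  finally show ?thesis unfolding eisenstein_def by blast
qed

lemma eisenstein_0_1: "0 \<in> eisenstein" "1 \<in> eisenstein"
proof -
  have "0 = of_int 0 + of_int 0 * \<sigma>" "1 = of_int 1 + of_int 0 * \<sigma>" by simp_all
  then show "0 \<in> eisenstein" "1 \<in> eisenstein" unfolding eisenstein_def by blast+
qed

lemma SL2_one: "mat 1 \<in> SL2"
  by (simp add: SL2_def mat_def eisenstein_0_1)  (simp add: det_2)

lemma SL2_mult: "A \<in> SL2 \<Longrightarrow> B \<in> SL2 \<Longrightarrow> A ** B \<in> SL2"
  by (auto simp: SL2_def det_mul)
     (auto simp: matrix_matrix_mult_def sum_2 intro!: eisenstein_add eisenstein_mult)

lemma SL2_inverse:
  assumes "A \<in> SL2"
  obtains B where "B \<in> SL2" "A ** B = mat 1" "B ** A = mat 1"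
proof
  define B :: "complex^2^2" where
    "B = vector [vector [A $ 2 $ 2, - A $ 1 $ 2], vector [- A $ 2 $ 1, A $ 1 $ 1]]"
  have d: "A $ 1 $ 1 * A $ 2 $ 2 - A $ 1 $ 2 * A $ 2 $ 1 = 1"
    using assms by (simp add: SL2_def det_2)
  show "B \<in> SL2"
    using assms by (auto simp: SL2_def B_def forall_2 det_2 vector_2 eisenstein_uminus algebra_simps)
  show "A ** B = mat 1" "B ** A = mat 1"
    using d by (auto simp: vec_eq_iff forall_2 matrix_matrix_mult_def sum_2 mat_def B_def vector_2
        algebra_simps)
qed

lemma moebius_one: "moebius_action (mat 1) x = x"
  by (cases x) (auto simp: mat_def fraction_def)

lemma moebius_fraction:
  assumes "\<not> (p = 0 \<and> q = 0)"
  shows "moebius_action A (fraction p q) = fraction (A $ 1 $ 1 * p + A $ 1 $ 2 * q) (A $ 2 $ 1 * p + A $ 2 $ 2 * q)"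
proof (cases "q = 0")
  case True
  with assms show ?thesis by (auto simp: fraction_def)
next
  case False
  have "A $ i $ 1 * (p / q) + A $ i $ 2 = (A $ i $ 1 * p + A $ i $ 2 * q) / q" for i
    using False by (simp add: field_simps)
  with False show ?thesis by (simp add: fraction_def)
qed

lemma moebius_mult:
  assumes "det B \<noteq> 0"
  shows "moebius_action (A ** B) x = moebius_action A (moebius_action B x)"
proof (cases x)
  case None
  have "\<not> (B $ 1 $ 1 = 0 \<and> B $ 2 $ 1 = 0)" using assms by (auto simp: det_2)
  with None show ?thesis
    by (simp add: moebius_fraction) (simp add: matrix_matrix_mult_def sum_2)
next
  case (Some z)
  have "\<not> (B $ 1 $ 1 * z + B $ 1 $ 2 = 0 \<and> B $ 2 $ 1 * z + B $ 2 $ 2 = 0)"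
  proof
    assume "B $ 1 $ 1 * z + B $ 1 $ 2 = 0 \<and> B $ 2 $ 1 * z + B $ 2 $ 2 = 0"
    then have "B $ 1 $ 2 = - (B $ 1 $ 1 * z)" "B $ 2 $ 2 = - (B $ 2 $ 1 * z)"
      by (simp_all add: eq_neg_iff_add_eq_0 add.commute)
    then have "det B = 0" by (simp add: det_2)
    with assms show False by simp
  qed
  with Some show ?thesis
    by (simp add: moebius_fraction) (simp add: matrix_matrix_mult_def sum_2 algebra_simps)
qed

lemma matrix_inv_eqI:
  fixes A B :: "complex^2^2"
  assumes "A ** B = mat 1" "B ** A = mat 1"
  shows "matrix_inv A = B"
proof -
  have "A ** matrix_inv A = mat 1 \<and> matrix_inv A ** A = mat 1"
    unfolding matrix_inv_def by (rule someI[of _ B]) (use assms in simp)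
  then have "matrix_inv A ** A ** B = B" by simp
  then show ?thesis using assms(1) by (simp flip: matrix_mul_assoc)
qed

lemma equiv_path_pair_equiv: "equiv (paths \<times> paths) path_pair_equiv"
proof (rule equivI)
  have inv_tr: "matrix_inv (transpose A) = transpose B" if "A ** B = mat 1" "B ** A = mat 1"
    for A B :: "complex^2^2"
    by (rule matrix_inv_eqI) (simp_all add: that flip: matrix_transpose_mul)
  have d: "det A \<noteq> 0" "det (transpose A) \<noteq> 0" if "A \<in> SL2" for A
    using that by (auto simp: SL2_def)
  show "path_pair_equiv \<subseteq> (paths \<times> paths) \<times> (paths \<times> paths)"
    by (auto simp: path_pair_equiv_def)
  have "matrix_inv (transpose (mat 1 :: complex^2^2)) = mat 1"
    by (rule matrix_inv_eqI) simp_all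
  then show "refl_on (paths \<times> paths) path_pair_equiv"
    unfolding refl_on_def path_pair_equiv_def
    by (auto intro!: bexI[OF _ SL2_one] simp: moebius_one)
  show "sym path_pair_equiv"
  proof (rule symI, clarify)
    fix u v u' v' assume "((u, v), (u', v')) \<in> path_pair_equiv"
    then obtain A where P: "u \<in> paths" "v \<in> paths" "u' \<in> paths" "v' \<in> paths" and A: "A \<in> SL2"
      "\<And>i. u' i = moebius_action A (u i)" "\<And>j. v' j = moebius_action (matrix_inv (transpose A)) (v j)"
      by (auto simp: path_pair_equiv_def)
    obtain B where B: "B \<in> SL2" "A ** B = mat 1" "B ** A = mat 1"
      using SL2_inverse A(1) by blast
    have "u i = moebius_action B (u' i)" for i
      using A B d by (simp add: moebius_one flip: moebius_mult)
    moreover have "v j = moebius_action (matrix_inv (transpose B)) (v' j)" for j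
      using A B d by (simp add: inv_tr moebius_one flip: moebius_mult matrix_transpose_mul)
    ultimately show "((u', v'), (u, v)) \<in> path_pair_equiv"
      using P B(1) unfolding path_pair_equiv_def by blast
  qed
  show "trans path_pair_equiv"
  proof (rule transI, clarify)
    fix u v u' v' u'' v''
    assume "((u, v), (u', v')) \<in> path_pair_equiv" "((u', v'), (u'', v'')) \<in> path_pair_equiv"
    then obtain A A' where P: "u \<in> paths" "v \<in> paths" "u'' \<in> paths" "v'' \<in> paths"
      and A: "A \<in> SL2" "\<And>i. u' i = moebius_action A (u i)"
        "\<And>j. v' j = moebius_action (matrix_inv (transpose A)) (v j)"
      and A': "A' \<in> SL2" "\<And>i. u'' i = moebius_action A' (u' i)"
        "\<And>j. v'' j = moebius_action (matrix_inv (transpose A')) (v' j)"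
      by (auto simp: path_pair_equiv_def)
    obtain B where B: "B \<in> SL2" "A ** B = mat 1" "B ** A = mat 1"
      using SL2_inverse A(1) by blast
    obtain B' where B': "B' \<in> SL2" "A' ** B' = mat 1" "B' ** A' = mat 1"
      using SL2_inverse A'(1) by blast
    have "(A' ** A) ** (B ** B') = A' ** (A ** B) ** B'" "(B ** B') ** (A' ** A) = B ** (B' ** A') ** A"
      by (simp_all add: matrix_mul_assoc)
    then have BB: "(A' ** A) ** (B ** B') = mat 1" "(B ** B') ** (A' ** A) = mat 1"
      using B B' by simp_all
    have "u'' i = moebius_action (A' ** A) (u i)" for i
      using A A' d by (simp add: moebius_mult)
    moreover have "v'' j = moebius_action (matrix_inv (transpose (A' ** A))) (v j)" for j
      using A A' B B' d inv_tr[OF BB] inv_tr[OF B(2,3)] inv_tr[OF B'(2,3)]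
      by (simp add: matrix_transpose_mul moebius_mult)
    ultimately show "((u, v), (u'', v'')) \<in> path_pair_equiv"
      using P SL2_mult[OF A'(1) A(1)] unfolding path_pair_equiv_def by blast
  qed
qed

end

theory Submission
  imports Defs
begin

text \<open>
  Two normalisations of a path differ by units $k_i$ with $k_i k_{i+1} = 1$, so $k_i = k_0^{(-1)^i}$,
  which makes the scalar product well defined up to tiling equivalence. If two pairs of
  normalisations have the same scalar products, the matrix $A$ that sends the first two vectors of
  one first path to those of the other is forced, by nondegeneracy of the pairing, to send every
  vector of the first path, and $(A^T)^{-1}$ every vector of the second, to its counterpart.
  Conversely, columns 0 and 1 of a tame tiling $m$ form a normalised path $(p_i, q_i)$. Tameness
  yields a recurrence $m_{i,j+2} = \<beta>_j m_{i,j+1} - m_{i,j}$ with $\<beta>_j$ independent of $i$,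
  so each column $j$ is a combination of these two columns with coefficients $r_j, s_j$ independent
  of $i$.
\<close>

subsection \<open>Units of the Eisenstein integers\<close>

lemma sigma_Re_Im: "Re \<sigma> = 1 / 2" "Im \<sigma> = sqrt 3 / 2"
proof -
  have "\<sigma> = Complex (1 / 2) (sqrt 3 / 2)"
    by (simp add: \<sigma>_def exp_eq_polar cis.ctr cos_60 sin_60 flip: cis_conv_exp)
  then show "Re \<sigma> = 1 / 2" "Im \<sigma> = sqrt 3 / 2" by (metis complex.sel)+
qed

lemma cmod_sigma: "cmod \<sigma> = 1"
  by (simp add: \<sigma>_def)

lemma eisenstein_diff: "x \<in> eisenstein \<Longrightarrow> y \<in> eisenstein \<Longrightarrow> x - y \<in> eisenstein"
  using eisenstein_add[OF _ eisenstein_uminus, of x y] by simp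

lemma sigma_in_eisenstein: "\<sigma> \<in> eisenstein"
proof -
  have "\<sigma> = of_int 0 + of_int 1 * \<sigma>" by simp
  then show ?thesis unfolding eisenstein_def by blast
qed

lemma of_int_in_eisenstein: "of_int n \<in> eisenstein"
proof -
  have "of_int n = of_int n + of_int 0 * \<sigma>" by simp
  then show ?thesis unfolding eisenstein_def by blast
qed

lemma eisenstein_cnj:
  assumes "x \<in> eisenstein" shows "cnj x \<in> eisenstein"
proof -
  obtain a b where x: "x = of_int a + of_int b * \<sigma>" using assms by (auto simp: eisenstein_def)
  have "cnj \<sigma> = 1 - \<sigma>" by (simp add: complex_eq_iff sigma_Re_Im)
  then have "cnj x = of_int a + of_int b * (1 - \<sigma>)" by (simp add: x)
  then show ?thesis
    by (simp add: eisenstein_add eisenstein_mult eisenstein_diff of_int_in_eisenstein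
        sigma_in_eisenstein eisenstein_0_1)
qed

text \<open>The norm form of the ring: \<open>\<sigma>\<close> has modulus 1 and real part 1/2, so
  the cross term is \<open>a * b\<close>. Its integrality drives all arguments on units.\<close>

lemma cmod_eisenstein_squared:
  "(cmod (of_int a + of_int b * \<sigma>))\<^sup>2 = of_int (a\<^sup>2 + a * b + b\<^sup>2)"
  by (simp add: cmod_power2 sigma_Re_Im power2_sum power_mult_distrib power_divide)

lemma eisenstein_cmod_ge_1:
  assumes "x \<in> eisenstein" "x \<noteq> 0" shows "1 \<le> cmod x"
proof -
  obtain a b where x: "x = of_int a + of_int b * \<sigma>" using assms by (auto simp: eisenstein_def)
  have "0 < (cmod x)\<^sup>2" using assms by simp
  then have "0 < a\<^sup>2 + a * b + b\<^sup>2"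
    unfolding x cmod_eisenstein_squared of_int_0_less_iff .
  then have "1 \<le> (cmod x)\<^sup>2"
    unfolding x cmod_eisenstein_squared by linarith
  then show ?thesis
    by (metis norm_ge_zero one_power2 power2_le_imp_le)
qed

text \<open>Both factors are nonzero, so each has modulus at least 1, while the moduli multiply to
  1.\<close>

lemma eisenstein_unitI:
  assumes "x \<in> eisenstein" "y \<in> eisenstein" "cmod (x * y) = 1" shows "cmod x = 1"
proof -
  have "1 \<le> cmod x" "1 \<le> cmod y"
    using assms(3) by (auto intro!: eisenstein_cmod_ge_1 assms)
  moreover have "cmod x * cmod y = 1" using assms(3) by (simp add: norm_mult)
  ultimately show ?thesis
    by (metis dual_order.antisym mult_left_mono mult.right_neutral norm_ge_zero)
qed

lemma unit_cnj: "cmod k = 1 \<Longrightarrow> k * cnj k = 1"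
  by (simp add: complex_norm_square[symmetric] flip: of_real_power)

lemma eisenstein_unit_inverse:
  assumes "k \<in> eisenstein" "cmod k = 1" shows "inverse k \<in> eisenstein"
  using inverse_unique[OF unit_cnj[OF assms(2)]] eisenstein_cnj[OF assms(1)] by simp

lemma sigma_powi_in_eisenstein: "\<sigma> powi n \<in> eisenstein"
proof -
  have nat: "\<sigma> ^ m \<in> eisenstein" for m
    by (induction m) (auto simp: eisenstein_0_1 sigma_in_eisenstein eisenstein_mult)
  then show ?thesis
    by (cases "0 \<le> n")
       (auto simp: power_int_def power_inverse norm_power cmod_sigma intro!: eisenstein_unit_inverse)
qed

lemma eisenstein_unit_eq_sigma_powi:
  assumes "k \<in> eisenstein" "cmod k = 1"
  obtains n where "k = \<sigma> powi n"
proof -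
  obtain a b where k: "k = of_int a + of_int b * \<sigma>" using assms by (auto simp: eisenstein_def)
  have "real_of_int (a\<^sup>2 + a * b + b\<^sup>2) = 1"
    using assms(2) unfolding k cmod_eisenstein_squared[symmetric] by simp
  then have norm: "a\<^sup>2 + a * b + b\<^sup>2 = 1" by linarith
  \<comment> \<open>Completing the square in either variable bounds both coefficients, leaving nine
    candidate pairs.\<close>
  have "3 * b\<^sup>2 = 4 * (a\<^sup>2 + a * b + b\<^sup>2) - (2 * a + b)\<^sup>2"
    "3 * a\<^sup>2 = 4 * (a\<^sup>2 + a * b + b\<^sup>2) - (2 * b + a)\<^sup>2"
    by (simp_all add: power2_eq_square algebra_simps)
  then have "3 * b\<^sup>2 \<le> 4" "3 * a\<^sup>2 \<le> 4" unfolding norm by simp_all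
  then have "b\<^sup>2 < 2\<^sup>2" "a\<^sup>2 < 2\<^sup>2" by simp_all
  then have "\<bar>a\<bar> < 2" "\<bar>b\<bar> < 2"
    using power2_less_imp_less[of "\<bar>a\<bar>" 2] power2_less_imp_less[of "\<bar>b\<bar>" 2] by simp_all
  then have "a \<in> {-1, 0, 1}" "b \<in> {-1, 0, 1}" by auto
  \<comment> \<open>The six pairs of norm 1, listed in the order of the powers of
    \<open>\<sigma>\<close> from 0 to 5.\<close>
  with norm have ab: "(a, b) \<in> {(1, 0), (0, 1), (-1, 1), (-1, 0), (0, -1), (1, -1)}"
    by auto
  have s2: "\<sigma> ^ 2 = \<sigma> - 1" by (simp add: power2_eq_square sigma_squared)
  have s3: "\<sigma> ^ 3 = -1"
    by (simp add: power3_eq_cube sigma_squared left_diff_distrib)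
  have "\<sigma> ^ 4 = \<sigma> ^ 3 * \<sigma>" "\<sigma> ^ 5 = \<sigma> ^ 3 * \<sigma> ^ 2" by (simp_all flip: power_Suc2 power_add)
  then have "\<sigma> powi 0 = 1" "\<sigma> powi 1 = \<sigma>" "\<sigma> powi 2 = \<sigma> - 1" "\<sigma> powi 3 = -1" "\<sigma> powi 4 = - \<sigma>"
    "\<sigma> powi 5 = 1 - \<sigma>"
    by (simp_all add: s2 s3)
  then have "\<exists>n. k = \<sigma> powi n" using ab unfolding k
    by (elim insertE emptyE; clarsimp; metis diff_conv_add_uminus add.commute)
  then show thesis using that by blast
qed

subsection \<open>Irreducible fractions and normalisations\<close>

text \<open>A common factor of \<open>p\<close> and \<open>q\<close> divides
  \<open>p * s - r * q\<close>, which is a unit.\<close>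

lemma irreducible_fractionI:
  assumes "p \<in> eisenstein" "q \<in> eisenstein" "r \<in> eisenstein" "s \<in> eisenstein"
    and "cmod (p * s - r * q) = 1"
  shows "irreducible_fraction p q"
  unfolding irreducible_fraction_def
proof (intro conjI ballI impI)
  show "\<not> (p = 0 \<and> q = 0)" using assms(5) by auto
  fix k assume k: "k \<in> eisenstein" "(\<exists>a\<in>eisenstein. p = k * a) \<and> (\<exists>b\<in>eisenstein. q = k * b)"
  then obtain a b where ab: "a \<in> eisenstein" "p = k * a" "b \<in> eisenstein" "q = k * b" by blast
  have "p * s - r * q = k * (a * s - r * b)" by (simp add: ab algebra_simps)
  with assms k ab show "cmod k = 1"
    by (metis eisenstein_unitI eisenstein_diff eisenstein_mult)
qed (use assms in auto)

lemma irreducible_fractionD: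
  assumes "irreducible_fraction p q"
  shows "p \<in> eisenstein" "q \<in> eisenstein" "\<not> (p = 0 \<and> q = 0)"
  using assms by (auto simp: irreducible_fraction_def)

lemma fraction_scale: "k \<noteq> 0 \<Longrightarrow> fraction (k * p) (k * q) = fraction p q"
  by (simp add: fraction_def)

lemma fraction_eqD:
  assumes "fraction p q = fraction p' q'" shows "p' * q = p * q'"
  using assms by (auto simp: fraction_def field_simps split: if_splits)

text \<open>The Bezout relation supplied by an adjacent vertex replaces unique factorisation.\<close>

lemma irreducible_fraction_unique:
  assumes "p \<in> eisenstein" "q \<in> eisenstein" "r \<in> eisenstein" "s \<in> eisenstein"
    and det: "cmod (p * s - r * q) = 1"
    and irr: "irreducible_fraction p' q'" and eq: "fraction p q = fraction p' q'"
  obtains k where "k \<in> eisenstein" "cmod k = 1" "p' = k * p" "q' = k * q"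
proof -
  define e where "e = p * s - r * q"
  \<comment> \<open>If \<open>p' = k * p\<close> and \<open>q' = k * q\<close>, then
    \<open>p' * s - r * q' = k * e\<close>; this forces the choice of \<open>k\<close>.\<close>
  define k where "k = inverse e * (p' * s - r * q')"
  have e: "e \<in> eisenstein" "cmod e = 1" "e \<noteq> 0"
    using assms by (auto simp: e_def eisenstein_diff eisenstein_mult)
  have cross: "p' * q = p * q'" by (rule fraction_eqD[OF eq])
  have k: "k \<in> eisenstein"
    using e assms irreducible_fractionD[OF irr]
    by (simp add: k_def eisenstein_unit_inverse eisenstein_diff eisenstein_mult)
  have "e * p' = (p' * s - r * q') * p" "e * q' = (p' * s - r * q') * q"
    using cross unfolding e_def by algebra+
  then have eq': "p' = k * p" "q' = k * q"
    using e(3) by (simp_all add: k_def field_simps)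
  then have "cmod k = 1" using irr k assms(1,2) unfolding irreducible_fraction_def by blast
  with k eq' show thesis using that by blast
qed

text \<open>Adjacency only provides some representatives, with determinant of modulus 1. Passing to
  the prescribed \<open>p\<close>, \<open>q\<close> multiplies the determinant by a unit, and
  dividing the neighbour's fraction by the result \<open>e\<close> makes it exactly 1.\<close>

lemma adjacent_step:
  assumes "adjacent x y" "irreducible_fraction p q" "x = fraction p q"
  obtains r s where "irreducible_fraction r s" "y = fraction r s" "p * s - r * q = 1"
proof -
  obtain p0 q0 r0 s0 where irr: "irreducible_fraction p0 q0" "irreducible_fraction r0 s0"
    and xy: "x = fraction p0 q0" "y = fraction r0 s0" and det: "cmod (p0 * s0 - r0 * q0) = 1"
    using assms(1) unfolding adjacent_def by blast
  note eis = irreducible_fractionD(1,2)[OF irr(1)] irreducible_fractionD(1,2)[OF irr(2)]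
    irreducible_fractionD(1,2)[OF assms(2)]
  obtain k where k: "k \<in> eisenstein" "cmod k = 1" "p = k * p0" "q = k * q0"
    using irreducible_fraction_unique[OF eis(1-4) det assms(2)] xy assms(3) by metis
  define e where "e = k * (p0 * s0 - r0 * q0)"
  have e: "e \<in> eisenstein" "cmod e = 1" "e \<noteq> 0"
    using k det eis by (auto simp: e_def norm_mult eisenstein_mult eisenstein_diff)
  let ?r = "inverse e * r0" and ?s = "inverse e * s0"
  have "p * ?s - ?r * q = inverse e * e" by (simp add: e_def k algebra_simps)
  then have d: "p * ?s - ?r * q = 1" using e by simp
  have "?r \<in> eisenstein" "?s \<in> eisenstein"
    using e eis by (auto intro!: eisenstein_mult eisenstein_unit_inverse)
  moreover have "cmod (?r * q - p * ?s) = 1"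
    using d by (simp add: norm_minus_commute)
  ultimately have "irreducible_fraction ?r ?s" using eis by (intro irreducible_fractionI)
  moreover have "y = fraction ?r ?s" using xy e by (simp add: fraction_scale)
  ultimately show thesis using that d by blast
qed

lemma adjacent_sym: "adjacent x y \<Longrightarrow> adjacent y x"
  unfolding adjacent_def by (metis norm_minus_commute mult.commute)

lemma adjacent_step_back:
  assumes "adjacent x y" "irreducible_fraction r s" "y = fraction r s"
  obtains p q where "irreducible_fraction p q" "x = fraction p q" "p * s - r * q = 1"
proof -
  obtain p q where pq: "irreducible_fraction p q" "x = fraction p q" "r * q - p * s = 1"
    using adjacent_step[OF adjacent_sym[OF assms(1)] assms(2,3)] by blast
  \<comment> \<open>Exchanging the two fractions reverses the sign of the determinant; negating
    \<open>p\<close> and \<open>q\<close> repairs this without moving the vertex.\<close>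
  have "(- p) * s - r * (- q) = 1" using pq(3) by simp
  moreover have "irreducible_fraction (- p) (- q)"
    by (rule irreducible_fractionI[of _ _ r s])
       (use pq calculation irreducible_fractionD[OF assms(2)] irreducible_fractionD[OF pq(1)] in
        \<open>auto simp: eisenstein_uminus\<close>)
  moreover have "x = fraction (- p) (- q)" using pq(2) by (simp add: fraction_def)
  ultimately show thesis using that by blast
qed

text \<open>Dependent choice along the integers: a forward and a backward run over the naturals both
  start at \<open>x0\<close> and are glued at 0.\<close>

lemma dependent_int_choice:
  fixes S :: "int \<Rightarrow> 'a \<Rightarrow> bool"
  assumes "S 0 x0"
    and step: "\<And>i x. S i x \<Longrightarrow> \<exists>y. S (i + 1) y \<and> R i x y"
    and back_step: "\<And>i y. S (i + 1) y \<Longrightarrow> \<exists>x. S i x \<and> R i x y"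
  shows "\<exists>f. \<forall>i. S i (f i) \<and> R i (f i) (f (i + 1))"
proof -
  have "\<exists>f. \<forall>n. (S (int n) (f n) \<and> (n = 0 \<longrightarrow> f n = x0)) \<and> R (int n) (f n) (f (Suc n))"
    using step assms(1) by (intro dependent_nat_choice) (fastforce simp: add.commute)+
  then obtain f where f: "\<And>n. S (int n) (f n)" "f 0 = x0" "\<And>n. R (int n) (f n) (f (Suc n))" by blast
  have "\<exists>g. \<forall>n. (S (- int n) (g n) \<and> (n = 0 \<longrightarrow> g n = x0)) \<and> R (- int n - 1) (g (Suc n)) (g n)"
  proof (rule dependent_nat_choice)
    fix x n assume "S (- int n) x \<and> (n = 0 \<longrightarrow> x = x0)"
    then show "\<exists>y. (S (- int (Suc n)) y \<and> (Suc n = 0 \<longrightarrow> y = x0)) \<and> R (- int n - 1) y x"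
      using back_step[of "- int n - 1" x] by (simp add: minus_diff_commute)
  qed (use assms(1) in auto)
  then obtain g where g: "\<And>n. S (- int n) (g n)" "g 0 = x0"
    "\<And>n. R (- int n - 1) (g (Suc n)) (g n)" by blast
  define h where "h i = (if 0 \<le> i then f (nat i) else g (nat (- i)))" for i :: int
  have "S i (h i) \<and> R i (h i) (h (i + 1))" for i
  proof (cases "0 \<le> i")
    case True
    then show ?thesis using f(1,3)[of "nat i"] by (simp add: h_def nat_add_distrib)
  next
    case False
    then obtain n where n: "i = - int n - 1" by (metis int_cases3 add.commute diff_conv_add_uminus
          minus_add_distrib negD not_le of_nat_Suc)
    have "h i = g (Suc n)" by (simp add: n h_def nat_add_distrib add.commute)
    \<comment> \<open>For \<open>n = 0\<close> the index \<open>i + 1\<close> is 0, where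
      \<open>h\<close> takes its value from \<open>f\<close>; there \<open>f 0\<close> and
      \<open>g 0\<close> are both \<open>x0\<close>.\<close>
    moreover have "h (i + 1) = g n" using f(2) g(2) by (simp add: n h_def)
    ultimately show ?thesis using g(1)[of "Suc n"] g(3)[of n] by (simp add: n minus_diff_commute)
  qed
  then show ?thesis by blast
qed

text \<open>An arbitrary irreducible fraction at index 0 is propagated in both directions, each step
  making the determinant equal to 1.\<close>

lemma normalisation_exists:
  assumes "v \<in> paths"
  obtains p q where "normalisation v p q"
proof -
  have adj: "adjacent (v i) (v (i + 1))" for i using assms by (auto simp: paths_def)
  obtain p0 q0 where pq0: "irreducible_fraction p0 q0" "v 0 = fraction p0 q0"
    using adj[of 0] unfolding adjacent_def by blast
  let ?S = "\<lambda>i (p, q). irreducible_fraction p q \<and> v i = fraction p q"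
  let ?R = "\<lambda>i (p, q) (r, s). p * s - r * q = (1 :: complex)"
  have "\<exists>f. \<forall>i. ?S i (f i) \<and> ?R i (f i) (f (i + 1))"
  proof (rule dependent_int_choice)
    show "?S 0 (p0, q0)" using pq0 by simp
  next
    fix i and x :: "complex \<times> complex" assume "?S i x"
    then show "\<exists>y. ?S (i + 1) y \<and> ?R i x y"
      by (cases x) (auto intro: adjacent_step[OF adj[of i]])
  next
    fix i and y :: "complex \<times> complex" assume "?S (i + 1) y"
    then show "\<exists>x. ?S i x \<and> ?R i x y"
      by (cases y) (auto intro: adjacent_step_back[OF adj[of i]])
  qed
  then obtain f where f: "\<And>i. ?S i (f i) \<and> ?R i (f i) (f (i + 1))" by blast
  have "normalisation v (\<lambda>i. fst (f i)) (\<lambda>i. snd (f i))"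
    unfolding normalisation_def using f by (auto simp: case_prod_beta)
  then show thesis by (rule that)
qed

text \<open>Irreducibility is automatic, since the next fraction supplies a Bezout relation.\<close>

lemma normalisation_detI:
  assumes "\<And>i. p i \<in> eisenstein" "\<And>i. q i \<in> eisenstein"
    and "\<And>i. v i = fraction (p i) (q i)" "\<And>i. p i * q (i + 1) - p (i + 1) * q i = 1"
  shows "normalisation v p q"
proof -
  have "irreducible_fraction (p i) (q i)" for i
    by (rule irreducible_fractionI[of _ _ "p (i + 1)" "q (i + 1)"]) (simp_all add: assms)
  with assms show ?thesis by (simp add: normalisation_def)
qed

lemma normalisationD:
  assumes "normalisation v p q"
  shows "p i \<in> eisenstein" "q i \<in> eisenstein" "v i = fraction (p i) (q i)"
    "p i * q (i + 1) - p (i + 1) * q i = 1" "\<not> (p i = 0 \<and> q i = 0)"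
  using assms by (auto simp: normalisation_def irreducible_fraction_def)

lemma fraction_in_vertices:
  assumes "p \<in> eisenstein" "q \<in> eisenstein" shows "fraction p q \<in> vertices"
proof (cases "q = 0")
  case False
  obtain c d where q: "q = of_int c + of_int d * \<sigma>" using assms by (auto simp: eisenstein_def)
  \<comment> \<open>Expanding by \<open>cnj q\<close> turns the denominator into the integer norm
    \<open>n\<close> of \<open>q\<close>, so the coordinates over 1 and \<open>\<sigma>\<close>
    become rational.\<close>
  define n where "n = c\<^sup>2 + c * d + d\<^sup>2"
  have n: "q * cnj q = of_int n"
    using arg_cong[OF cmod_eisenstein_squared[of c d], of complex_of_real]
    by (simp only: complex_norm_square[symmetric] q n_def of_real_of_int_eq)
  obtain a b where ab: "p * cnj q = of_int a + of_int b * \<sigma>"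
    using eisenstein_mult[OF assms(1) eisenstein_cnj[OF assms(2)]] by (auto simp: eisenstein_def)
  have "p / q = (p * cnj q) / (q * cnj q)" using False by simp
  also have "\<dots> = of_rat (of_int a / of_int n) + of_rat (of_int b / of_int n) * \<sigma>"
    by (simp add: n ab of_rat_divide add_divide_distrib)
  finally show ?thesis using False unfolding vertices_def fraction_def eisenstein_field_def by auto
qed (simp add: fraction_def vertices_def)

lemma normalisation_in_paths:
  assumes "normalisation v p q" shows "v \<in> paths"
proof -
  have "adjacent (v i) (v (i + 1))" for i
    using assms unfolding adjacent_def normalisation_def by (metis norm_one)
  moreover have "v i \<in> vertices" for i
    using normalisationD[OF assms] fraction_in_vertices by metis
  ultimately show ?thesis by (auto simp: paths_def)
qed

section \<open>The alternating unit ambiguity of normalisations\<close>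

lemma sign_succ: "(-1 :: int) ^ nat \<bar>i + 1\<bar> = - ((-1) ^ nat \<bar>i\<bar>)"
  by (cases "even i") (auto simp: minus_one_power_iff even_nat_iff)

text \<open>Consecutive exponents are opposite, so the two factors cancel in every
  determinant.\<close>

lemma normalisation_rescale:
  assumes "normalisation v p q"
  shows "normalisation v (\<lambda>i. \<sigma> powi ((-1) ^ nat \<bar>i\<bar> * n) * p i) (\<lambda>i. \<sigma> powi ((-1) ^ nat \<bar>i\<bar> * n) * q i)"
proof (rule normalisation_detI)
  fix i
  let ?k = "\<lambda>i. \<sigma> powi ((-1) ^ nat \<bar>i\<bar> * n)"
  note D = normalisationD[OF assms]
  show "?k i * p i \<in> eisenstein" "?k i * q i \<in> eisenstein"
    using D by (auto intro!: eisenstein_mult sigma_powi_in_eisenstein)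
  show "v i = fraction (?k i * p i) (?k i * q i)"
    using D(3) sigma_nonzero by (simp add: fraction_scale)
  have "?k i * ?k (i + 1) = 1"
    using sigma_nonzero by (simp add: sign_succ flip: power_int_add)
  then show "?k i * p i * (?k (i + 1) * q (i + 1)) - ?k (i + 1) * p (i + 1) * (?k i * q i) = 1"
    using D(4)[of i] by algebra
qed

lemma normalisation_unique:
  assumes "normalisation v p q" "normalisation v p' q'"
  shows "\<exists>n. \<forall>i. p' i = \<sigma> powi ((-1) ^ nat \<bar>i\<bar> * n) * p i \<and>
    q' i = \<sigma> powi ((-1) ^ nat \<bar>i\<bar> * n) * q i"
proof -
  note D = normalisationD[OF assms(1)] and D' = normalisationD[OF assms(2)]
  have "\<exists>k. k \<in> eisenstein \<and> cmod k = 1 \<and> p' i = k * p i \<and> q' i = k * q i" for i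
    using irreducible_fraction_unique[of "p i" "q i" "p (i + 1)" "q (i + 1)" "p' i" "q' i"] assms(2) D D'(3)
    unfolding normalisation_def by (metis norm_one)
  then obtain k where k: "\<And>i. k i \<in> eisenstein" "\<And>i. cmod (k i) = 1"
    "\<And>i. p' i = k i * p i" "\<And>i. q' i = k i * q i" by metis
  obtain n where n: "k 0 = \<sigma> powi n" using eisenstein_unit_eq_sigma_powi k(1,2) by blast
  \<comment> \<open>Both determinants are 1, and the second is the first times
    \<open>k i * k (i + 1)\<close>.\<close>
  have kk: "k i * k (i + 1) = 1" for i
    using D(4)[of i] D'(4)[of i] unfolding k by algebra
  have "k i = \<sigma> powi ((-1) ^ nat \<bar>i\<bar> * n)" for i
  proof (induction i rule: int_induct[of _ 0])
    case base
    then show ?case by (simp add: n)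
  next
    case (step1 i)
    have "k (i + 1) = inverse (k i)" using inverse_unique[OF kk[of i]] by simp
    then show ?case
      by (simp only: step1 sign_succ power_int_minus flip: minus_mult_left)
  next
    case (step2 i)
    have "k (i - 1) * k i = 1" using kk[of "i - 1"] by simp
    then have "k (i - 1) = inverse (k i)" using inverse_unique[of "k i" "k (i - 1)"] by (simp add: mult.commute)
    then show ?case using sign_succ[of "i - 1"] by (simp add: step2 flip: power_int_minus)
  qed
  then show ?thesis using k(3,4) by (intro exI[of _ n]) simp
qed

subsection \<open>Tilings as scalar products\<close>

text \<open>The tiling is the product of the matrix with rows \<open>(p i, q i)\<close> and the
  matrix with columns \<open>(r j, s j)\<close>. Its adjacent 2x2 minors are products of two
  determinants equal to 1, and its rank is at most 2, so the 3x3 minors vanish.\<close>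

lemma scalar_product_tiling_tame:
  assumes "normalisation u p q" "normalisation v r s"
  shows "scalar_product_tiling p q r s \<in> tame_tilings"
proof -
  note D = normalisationD[OF assms(1)] and D' = normalisationD[OF assms(2)]
  have "(p i * r j + q i * s j) * (p (i + 1) * r (j + 1) + q (i + 1) * s (j + 1)) -
    (p i * r (j + 1) + q i * s (j + 1)) * (p (i + 1) * r j + q (i + 1) * s j) = 1" for i j
    using D(4)[of i] D'(4)[of j] by algebra
  moreover have "tame (scalar_product_tiling p q r s)"
    unfolding tame_def scalar_product_tiling_def det_3 vector_3 by (intro allI) algebra
  ultimately show ?thesis
    using D(1,2) D'(1,2)
    by (simp add: tame_tilings_def SL2_tiling_def scalar_product_tiling_def eisenstein_add
        eisenstein_mult)
qed

lemma scalar_product_tiling_unique: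
  assumes "normalisation u p q" "normalisation u p' q'" "normalisation v r s" "normalisation v r' s'"
  shows "(scalar_product_tiling p q r s, scalar_product_tiling p' q' r' s') \<in> tiling_equiv"
proof -
  obtain n where n: "\<And>i. p' i = \<sigma> powi ((-1) ^ nat \<bar>i\<bar> * n) * p i"
    "\<And>i. q' i = \<sigma> powi ((-1) ^ nat \<bar>i\<bar> * n) * q i" using normalisation_unique[OF assms(1,2)] by blast
  obtain l where l: "\<And>i. r' i = \<sigma> powi ((-1) ^ nat \<bar>i\<bar> * l) * r i"
    "\<And>i. s' i = \<sigma> powi ((-1) ^ nat \<bar>i\<bar> * l) * s i" using normalisation_unique[OF assms(3,4)] by blast
  have "scalar_product_tiling p' q' r' s' i j =
    \<sigma> powi ((-1) ^ nat \<bar>i\<bar> * n + (-1) ^ nat \<bar>j\<bar> * l) * scalar_product_tiling p q r s i j" for i j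
    unfolding scalar_product_tiling_def n l power_int_add[OF disjI1[OF sigma_nonzero]] by algebra
  then show ?thesis using scalar_product_tiling_tame assms unfolding tiling_equiv_def by blast
qed

section \<open>Invariance under the simultaneous action on both paths\<close>

lemma contragredient_matrix:
  assumes "a * d - b * c = 1"
  defines "A \<equiv> vector [vector [a, b], vector [c, d]] :: complex^2^2"
  shows "matrix_inv (transpose A) = vector [vector [d, - c], vector [- b, a]]"
  by (rule matrix_inv_eqI)
     (use assms(1) in \<open>auto simp: A_def transpose_def vec_eq_iff forall_2 matrix_matrix_mult_def sum_2
        mat_def vector_2 algebra_simps\<close>)

text \<open>Restates the equivalence through four matrix entries with the inverse transpose written
  out, so that later goals become polynomial identities.\<close>

lemma path_pair_equiv_iff:
  "((u, v), (u', v')) \<in> path_pair_equiv \<longleftrightarrow>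
    u \<in> paths \<and> v \<in> paths \<and> u' \<in> paths \<and> v' \<in> paths \<and>
    (\<exists>a\<in>eisenstein. \<exists>b\<in>eisenstein. \<exists>c\<in>eisenstein. \<exists>d\<in>eisenstein. a * d - b * c = 1 \<and>
      (\<forall>i. u' i = moebius_action (vector [vector [a, b], vector [c, d]]) (u i)) \<and>
      (\<forall>j. v' j = moebius_action (vector [vector [d, - c], vector [- b, a]]) (v j)))"
  (is "_ \<longleftrightarrow> ?P \<and> ?Q \<and> ?R \<and> ?S \<and> ?E")
proof -
  have "(\<exists>A\<in>SL2. (\<forall>i. u' i = moebius_action A (u i)) \<and>
      (\<forall>j. v' j = moebius_action (matrix_inv (transpose A)) (v j))) \<longleftrightarrow> ?E" (is "?L \<longleftrightarrow> ?E")
  proof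
    assume ?L
    then obtain A where A: "A \<in> SL2" "\<And>i. u' i = moebius_action A (u i)"
      "\<And>j. v' j = moebius_action (matrix_inv (transpose A)) (v j)" by blast
    have eqA: "A = vector [vector [A $ 1 $ 1, A $ 1 $ 2], vector [A $ 2 $ 1, A $ 2 $ 2]]"
      by (simp add: vec_eq_iff forall_2 vector_2)
    have det: "A $ 1 $ 1 * A $ 2 $ 2 - A $ 1 $ 2 * A $ 2 $ 1 = 1" and
      e: "\<And>i j. A $ i $ j \<in> eisenstein"
      using A(1) by (auto simp: SL2_def det_2)
    from A(2,3) show ?E
      unfolding contragredient_matrix[OF det, folded eqA]
      using eqA det e by metis
  next
    assume ?E
    then obtain a b c d where e: "a \<in> eisenstein" "b \<in> eisenstein" "c \<in> eisenstein" "d \<in> eisenstein"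
      and det: "a * d - b * c = 1"
      and uv: "\<And>i. u' i = moebius_action (vector [vector [a, b], vector [c, d]]) (u i)"
        "\<And>j. v' j = moebius_action (vector [vector [d, - c], vector [- b, a]]) (v j)" by blast
    have "vector [vector [a, b], vector [c, d]] \<in> SL2"
      using e det by (simp add: SL2_def det_2 forall_2 vector_2)
    then show ?L using uv contragredient_matrix[OF det] by metis
  qed
  then show ?thesis by (simp add: path_pair_equiv_def)
qed

text \<open>A matrix of determinant 1 applied to all vectors \<open>(p i, q i)\<close> preserves the
  determinants of consecutive ones.\<close>

lemma normalisation_moebius:
  assumes "normalisation v p q" "a \<in> eisenstein" "b \<in> eisenstein" "c \<in> eisenstein" "d \<in> eisenstein"
    and "a * d - b * c = 1"
    and "\<And>i. v' i = moebius_action (vector [vector [a, b], vector [c, d]]) (v i)"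
  shows "normalisation v' (\<lambda>i. a * p i + b * q i) (\<lambda>i. c * p i + d * q i)"
proof (rule normalisation_detI)
  fix i
  note D = normalisationD[OF assms(1)]
  show "a * p i + b * q i \<in> eisenstein" "c * p i + d * q i \<in> eisenstein"
    using D assms(2-5) by (auto intro!: eisenstein_add eisenstein_mult)
  show "v' i = fraction (a * p i + b * q i) (c * p i + d * q i)"
    using D(3)[of i] D(5)[of i] assms(7)[of i] by (simp add: moebius_fraction vector_2)
  show "(a * p i + b * q i) * (c * p (i + 1) + d * q (i + 1)) -
    (a * p (i + 1) + b * q (i + 1)) * (c * p i + d * q i) = 1"
    using D(4)[of i] assms(6) by algebra
qed

text \<open>The pairing \<open>p * r + q * s\<close> does not change when \<open>A\<close> acts on
  the first vector and \<open>(A^T)^{-1}\<close> on the second. Transporting normalisations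
  therefore keeps the tiling itself, and any other normalisations stay within its class.\<close>

lemma scalar_product_tiling_cong:
  assumes "((u, v), (u', v')) \<in> path_pair_equiv"
    and "normalisation u p q" "normalisation v r s" "normalisation u' p' q'" "normalisation v' r' s'"
  shows "(scalar_product_tiling p q r s, scalar_product_tiling p' q' r' s') \<in> tiling_equiv"
proof -
  obtain a b c d where e: "a \<in> eisenstein" "b \<in> eisenstein" "c \<in> eisenstein" "d \<in> eisenstein"
    and det: "a * d - b * c = 1"
    and uv: "\<And>i. u' i = moebius_action (vector [vector [a, b], vector [c, d]]) (u i)"
      "\<And>j. v' j = moebius_action (vector [vector [d, - c], vector [- b, a]]) (v j)"
    using assms(1) unfolding path_pair_equiv_iff by blast
  have "normalisation u' (\<lambda>i. a * p i + b * q i) (\<lambda>i. c * p i + d * q i)"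
    by (rule normalisation_moebius[OF assms(2) e det uv(1)])
  moreover have "normalisation v' (\<lambda>i. d * r i + - c * s i) (\<lambda>i. - b * r i + a * s i)"
    by (rule normalisation_moebius[OF assms(3)])
       (use e det uv in \<open>auto simp: eisenstein_uminus algebra_simps\<close>)
  ultimately have "(scalar_product_tiling (\<lambda>i. a * p i + b * q i) (\<lambda>i. c * p i + d * q i)
      (\<lambda>i. d * r i + - c * s i) (\<lambda>i. - b * r i + a * s i), scalar_product_tiling p' q' r' s') \<in> tiling_equiv"
    by (rule scalar_product_tiling_unique[OF _ assms(4) _ assms(5)])
  moreover have "scalar_product_tiling (\<lambda>i. a * p i + b * q i) (\<lambda>i. c * p i + d * q i)
      (\<lambda>i. d * r i + - c * s i) (\<lambda>i. - b * r i + a * s i) = scalar_product_tiling p q r s"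
    unfolding scalar_product_tiling_def using det by (intro ext) algebra
  ultimately show ?thesis by simp
qed

section \<open>Injectivity: recovering the paths from their tiling\<close>

lemma unimodular_kernel:
  fixes x y :: complex
  assumes "p * q' - p' * q = 1" "p * x + q * y = 0" "p' * x + q' * y = 0"
  shows "x = 0" "y = 0"
  using assms by algebra+

lemma path_pair_equiv_if_same_tiling:
  assumes "normalisation u p q" "normalisation v r s" "normalisation u' p' q'" "normalisation v' r' s'"
    and eq: "scalar_product_tiling p q r s = scalar_product_tiling p' q' r' s'"
  shows "((u, v), (u', v')) \<in> path_pair_equiv"
proof -
  note D = normalisationD[OF assms(1)] normalisationD[OF assms(2)]
    normalisationD[OF assms(3)] normalisationD[OF assms(4)]
  have eq': "p i * r j + q i * s j = p' i * r' j + q' i * s' j" for i j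
    using fun_cong[OF fun_cong[OF eq], of i j] by (simp add: scalar_product_tiling_def)
  \<comment> \<open>The entries of \<open>A = M' * M^{-1}\<close>, where \<open>M\<close> and
    \<open>M'\<close> have the vectors of the two first paths at indices 0 and 1 as columns.\<close>
  define a b c d where abcd: "a = p' 0 * q 1 - p' 1 * q 0" "b = p' 1 * p 0 - p' 0 * p 1"
    "c = q' 0 * q 1 - q' 1 * q 0" "d = q' 1 * p 0 - q' 0 * p 1"
  have e: "a \<in> eisenstein" "b \<in> eisenstein" "c \<in> eisenstein" "d \<in> eisenstein"
    unfolding abcd by (auto intro!: eisenstein_diff eisenstein_mult D)
  have dp: "p 0 * q 1 - p 1 * q 0 = 1" "p' 0 * q' 1 - p' 1 * q' 0 = 1"
    and dr': "r' 0 * s' 1 - r' 1 * s' 0 = 1"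
    using D(4)[of 0] D(14)[of 0] D(19)[of 0] by simp_all
  have det: "a * d - b * c = 1" unfolding abcd using dp by algebra
  have A: "p' 0 = a * p 0 + b * q 0" "q' 0 = c * p 0 + d * q 0"
    "p' 1 = a * p 1 + b * q 1" "q' 1 = c * p 1 + d * q 1"
    unfolding abcd using dp by algebra+
  \<comment> \<open>Pairing with the two basis vectors at \<open>i = 0\<close> and
    \<open>i = 1\<close> determines \<open>(r j, s j)\<close>; since \<open>A\<close> carries these
    to their primed counterparts, it equals \<open>A^T\<close> applied to
    \<open>(r' j, s' j)\<close>.\<close>
  have rs: "r j = a * r' j + c * s' j \<and> s j = b * r' j + d * s' j" for j
  proof -
    have "p 0 * (a * r' j + c * s' j - r j) + q 0 * (b * r' j + d * s' j - s j) = 0"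
      "p 1 * (a * r' j + c * s' j - r j) + q 1 * (b * r' j + d * s' j - s j) = 0"
      using eq'[of 0 j] eq'[of 1 j] unfolding A by algebra+
    from unimodular_kernel[OF dp(1) this] show ?thesis by simp
  qed
  \<comment> \<open>Now the roles switch: pairing with the second path at 0 and 1 shows that
    \<open>A\<close> is correct at every \<open>i\<close>, not only at the two indices defining
    it.\<close>
  have pq: "p' i = a * p i + b * q i \<and> q' i = c * p i + d * q i" for i
  proof -
    have "r' 0 * (p' i - (a * p i + b * q i)) + s' 0 * (q' i - (c * p i + d * q i)) = 0"
      "r' 1 * (p' i - (a * p i + b * q i)) + s' 1 * (q' i - (c * p i + d * q i)) = 0"
      using eq'[of i 0] eq'[of i 1] rs[of 0] rs[of 1] by algebra+
    from unimodular_kernel[OF dr' this] show ?thesis by simp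
  qed
  have "r' j = d * r j + - c * s j \<and> s' j = - b * r j + a * s j" for j
    using rs[of j] det by algebra
  then have "v' j = moebius_action (vector [vector [d, - c], vector [- b, a]]) (v j)" for j
    using D(8,10,18)[of j] by (simp add: moebius_fraction vector_2)
  moreover have "u' i = moebius_action (vector [vector [a, b], vector [c, d]]) (u i)" for i
    using D(3,5,13)[of i] pq[of i] by (simp add: moebius_fraction vector_2)
  ultimately show ?thesis
    unfolding path_pair_equiv_iff using e det assms(1-4) normalisation_in_paths by blast
qed

text \<open>The factors relating the two tilings are absorbed by rescaling the first normalisation
  with \<open>k\<close> and the second with \<open>l\<close>, which reduces to equal
  tilings.\<close>

lemma path_pair_equiv_if_tiling_equiv:
  assumes "normalisation u p q" "normalisation v r s" "normalisation u' p' q'" "normalisation v' r' s'"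
    and "(scalar_product_tiling p q r s, scalar_product_tiling p' q' r' s') \<in> tiling_equiv"
  shows "((u, v), (u', v')) \<in> path_pair_equiv"
proof -
  obtain k l where kl: "\<And>i j. scalar_product_tiling p' q' r' s' i j =
      \<sigma> powi ((-1) ^ nat \<bar>i\<bar> * k + (-1) ^ nat \<bar>j\<bar> * l) * scalar_product_tiling p q r s i j"
    using assms(5) by (auto simp: tiling_equiv_def)
  show ?thesis
  proof (rule path_pair_equiv_if_same_tiling[OF normalisation_rescale[OF assms(1), of k]
        normalisation_rescale[OF assms(2), of l] assms(3,4)])
    show "scalar_product_tiling (\<lambda>i. \<sigma> powi ((-1) ^ nat \<bar>i\<bar> * k) * p i) (\<lambda>i. \<sigma> powi ((-1) ^ nat \<bar>i\<bar> * k) * q i)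
      (\<lambda>i. \<sigma> powi ((-1) ^ nat \<bar>i\<bar> * l) * r i) (\<lambda>i. \<sigma> powi ((-1) ^ nat \<bar>i\<bar> * l) * s i) =
      scalar_product_tiling p' q' r' s'"
      by (intro ext, unfold kl, unfold scalar_product_tiling_def power_int_add[OF disjI1[OF sigma_nonzero]])
         algebra
  qed
qed

section \<open>Surjectivity: factoring a tame tiling\<close>

lemma tame_tiling_recurrence:
  assumes "m \<in> tame_tilings"
  obtains \<beta> where "\<And>i j. m i (j + 2) = \<beta> j * m i (j + 1) - m i j"
proof -
  have sl: "m i j * m (i + 1) (j + 1) - m i (j + 1) * m (i + 1) j = 1" for i j
    using assms by (auto simp: tame_tilings_def SL2_tiling_def)
  have "m (i + 1 + 1) j = m (i + 2) j" for i j by (simp add: add.assoc)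
  note sl' = sl[of "i + 1" for i, unfolded this]
  have shift: "j + 1 + 1 = j + 2" for j :: int by simp
  \<comment> \<open>Cramer's rule in rows \<open>i\<close> and \<open>i + 1\<close> writes column
    \<open>j + 2\<close> in terms of columns \<open>j + 1\<close> and \<open>j\<close>. The first
    coefficient is the minor \<open>B i j\<close>; the second is -1 because the minor on columns
    \<open>j + 1\<close> and \<open>j + 2\<close> is 1.\<close>
  define B where "B i j = m i j * m (i + 1) (j + 2) - m i (j + 2) * m (i + 1) j" for i j
  have rec: "m i (j + 2) = B i j * m i (j + 1) - m i j"
    "m (i + 1) (j + 2) = B i j * m (i + 1) (j + 1) - m (i + 1) j" for i j
    using sl[of i j] sl[of i "j + 1", unfolded shift] unfolding B_def by algebra+
  \<comment> \<open>Subtracting this combination from the last column reduces the vanishing 3x3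
    determinant to the defect in row \<open>i + 2\<close> times a 2x2 minor equal to 1.\<close>
  have rec2: "m (i + 2) (j + 2) = B i j * m (i + 2) (j + 1) - m (i + 2) j" for i j
  proof -
    have "m i j * m (i + 1) (j + 1) * m (i + 2) (j + 2) + m i (j + 1) * m (i + 1) (j + 2) * m (i + 2) j
      + m i (j + 2) * m (i + 1) j * m (i + 2) (j + 1) - m i j * m (i + 1) (j + 2) * m (i + 2) (j + 1)
      - m i (j + 1) * m (i + 1) j * m (i + 2) (j + 2) - m i (j + 2) * m (i + 1) (j + 1) * m (i + 2) j = 0"
      using assms by (simp add: tame_tilings_def tame_def det_3 vector_3)
    with sl[of i j] rec[of i j] show ?thesis by algebra
  qed
  \<comment> \<open>Rows \<open>i + 1\<close> and \<open>i + 2\<close> both obey the recurrence with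
    coefficient \<open>B i j\<close>, and inserting it into the minor \<open>B (i + 1) j\<close>
    returns that coefficient.\<close>
  have "B (i + 1) j = B i j" for i j
  proof -
    have "B (i + 1) j = m (i + 1) j * m (i + 2) (j + 2) - m (i + 1) (j + 2) * m (i + 2) j"
      by (simp add: B_def add.assoc)
    also have "\<dots> = B i j * (m (i + 1) j * m (i + 2) (j + 1) - m (i + 1) (j + 1) * m (i + 2) j)"
      unfolding rec(2)[of i j] rec2[of i j] by (simp add: algebra_simps)
    finally show ?thesis by (simp add: sl')
  qed
  then have "B i j = B 0 j" for i j
    by (induction i rule: int_induct[of _ 0]) (simp, simp, metis diff_add_cancel)
  then show thesis using rec(1) that[of "B 0"] by metis
qed

lemma tame_tiling_scalar_product:
  assumes "m \<in> tame_tilings"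
  obtains u v p q r s where "normalisation u p q" "normalisation v r s"
    "m = scalar_product_tiling p q r s"
proof -
  have sl: "m i j * m (i + 1) (j + 1) - m i (j + 1) * m (i + 1) j = 1"
    and eis: "m i j \<in> eisenstein" for i j
    using assms by (auto simp: tame_tilings_def SL2_tiling_def)
  obtain \<beta> where \<beta>: "\<And>i j. m i (j + 2) = \<beta> j * m i (j + 1) - m i j"
    using tame_tiling_recurrence assms by blast
  \<comment> \<open>\<open>r j\<close> and \<open>s j\<close> are the Cramer coordinates of column
    \<open>j\<close> with respect to columns 0 and 1, computed from rows 0 and 1.\<close>
  define p q r s where pqrs: "p = (\<lambda>i. m i 0)" "q = (\<lambda>i. m i 1)"
    "r = (\<lambda>j. m 0 j * m 1 1 - m 1 j * m 0 1)" "s = (\<lambda>j. m 0 0 * m 1 j - m 1 0 * m 0 j)"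
  have sl0: "m 0 0 * m 1 1 - m 0 1 * m 1 0 = 1" using sl[of 0 0] by simp
  have "normalisation (\<lambda>i. fraction (p i) (q i)) p q"
  proof (rule normalisation_detI)
    show "p i * q (i + 1) - p (i + 1) * q i = 1" for i
      using sl[of i 0] by (simp add: pqrs algebra_simps)
  qed (auto simp: pqrs eis)
  moreover have "normalisation (\<lambda>i. fraction (r i) (s i)) r s"
  proof (rule normalisation_detI)
    show "r i * s (i + 1) - r (i + 1) * s i = 1" for i
      using sl[of 0 i] sl0 unfolding pqrs add_0 by algebra
  qed (auto simp: pqrs intro!: eisenstein_diff eisenstein_mult eis)
  moreover
  \<comment> \<open>The defect \<open>e\<close> obeys the recurrence in \<open>j\<close>, because
    \<open>r\<close> and \<open>s\<close> are linear in the entries of column \<open>j\<close>. It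
    vanishes in columns 0 and 1.\<close>
  define e where "e i j = m i j - (p i * r j + q i * s j)" for i j
  have e01: "e i 0 = 0" "e i 1 = 0" for i
    unfolding e_def pqrs using sl0 by algebra+
  have e2: "e i (j + 2) = \<beta> j * e i (j + 1) - e i j" for i j
    unfolding e_def pqrs \<beta>[of _ j] by (simp add: algebra_simps)
  \<comment> \<open>Two neighbouring columns are carried along because the recurrence has order two;
    it can be solved in both directions.\<close>
  have "e i j = 0 \<and> e i (j + 1) = 0" for i j
  proof (induction j rule: int_induct[of _ 0])
    case base
    then show ?case by (simp add: e01)
  next
    case (step1 j)
    then show ?case using e2[of i j] by (simp add: add.assoc)
  next
    case (step2 j)
    then show ?case using e2[of i "j - 1"] by (simp add: add.commute)
  qed
  then have "m = scalar_product_tiling p q r s"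
    by (intro ext) (simp add: e_def scalar_product_tiling_def)
  ultimately show thesis using that by blast
qed

section \<open>The map on equivalence classes\<close>

lemma scalar_product_map_class:
  assumes "normalisation u p q" "normalisation v r s"
  shows "scalar_product_map (path_pair_equiv `` {(u, v)}) = tiling_equiv `` {scalar_product_tiling p q r s}"
    (is "?L = ?R")
proof
  \<comment> \<open>Every class in the union defining the map comes from an equivalent pair, so its
    tiling is equivalent to the given one and the union collapses to a single class.\<close>
  show "?L \<subseteq> ?R"
  proof
    fix m assume "m \<in> ?L"
    then obtain u' v' p' q' r' s' where *: "((u, v), (u', v')) \<in> path_pair_equiv"
      "normalisation u' p' q'" "normalisation v' r' s'"
      "(scalar_product_tiling p' q' r' s', m) \<in> tiling_equiv"
      unfolding scalar_product_map_def by blast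
    then have "(scalar_product_tiling p q r s, scalar_product_tiling p' q' r' s') \<in> tiling_equiv"
      using scalar_product_tiling_cong assms by blast
    with *(4) show "m \<in> ?R"
      using equiv_tiling_equiv by (meson Image_singleton_iff equivE transE)
  qed
  have "((u, v), (u, v)) \<in> path_pair_equiv"
    using equiv_class_self[OF equiv_path_pair_equiv] normalisation_in_paths assms by blast
  then show "?R \<subseteq> ?L" unfolding scalar_product_map_def using assms by blast
qed

theorem theorem5p18:
  shows "bij_betw scalar_product_map ((paths \<times> paths) // path_pair_equiv) (tame_tilings // tiling_equiv) \<and>
    (\<forall>u\<in>paths. \<forall>v\<in>paths. \<forall>p q r s. normalisation u p q \<and> normalisation v r s \<longrightarrow>
       scalar_product_tiling p q r s \<in> tame_tilings \<and>
       scalar_product_map (path_pair_equiv `` {(u, v)}) = tiling_equiv `` {scalar_product_tiling p q r s})"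
proof (intro conjI ballI allI impI)
  \<comment> \<open>Each class is handled through one representative pair with chosen
    normalisations, on which \<open>scalar_product_map_class\<close> evaluates the map.\<close>
  have reps: "\<exists>u v p q r s. X = path_pair_equiv `` {(u, v)} \<and> normalisation u p q \<and> normalisation v r s"
    if "X \<in> (paths \<times> paths) // path_pair_equiv" for X
    using that by (elim quotientE) (metis SigmaE normalisation_exists)
  show "bij_betw scalar_product_map ((paths \<times> paths) // path_pair_equiv) (tame_tilings // tiling_equiv)"
  proof (rule bij_betwI')
    fix X Y assume "X \<in> (paths \<times> paths) // path_pair_equiv" "Y \<in> (paths \<times> paths) // path_pair_equiv"
    then obtain u v p q r s u' v' p' q' r' s' where
      X: "X = path_pair_equiv `` {(u, v)}" "normalisation u p q" "normalisation v r s" and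
      Y: "Y = path_pair_equiv `` {(u', v')}" "normalisation u' p' q'" "normalisation v' r' s'"
      using reps by metis
    show "scalar_product_map X = scalar_product_map Y \<longleftrightarrow> X = Y"
    proof
      assume "scalar_product_map X = scalar_product_map Y"
      then have "(scalar_product_tiling p q r s, scalar_product_tiling p' q' r' s') \<in> tiling_equiv"
        using X Y scalar_product_map_class scalar_product_tiling_tame
          eq_equiv_class[OF _ equiv_tiling_equiv] by metis
      then have "((u, v), (u', v')) \<in> path_pair_equiv"
        by (rule path_pair_equiv_if_tiling_equiv[OF X(2,3) Y(2,3)])
      then show "X = Y" unfolding X(1) Y(1) by (rule equiv_class_eq[OF equiv_path_pair_equiv])
    qed simp
  next
    fix X assume "X \<in> (paths \<times> paths) // path_pair_equiv"
    then show "scalar_product_map X \<in> tame_tilings // tiling_equiv"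
      using reps scalar_product_map_class scalar_product_tiling_tame quotientI by metis
  next
    fix M assume "M \<in> tame_tilings // tiling_equiv"
    then obtain m where m: "M = tiling_equiv `` {m}" "m \<in> tame_tilings" by (rule quotientE)
    obtain u v p q r s where *: "normalisation u p q" "normalisation v r s"
      "m = scalar_product_tiling p q r s" using tame_tiling_scalar_product m(2) .
    have "path_pair_equiv `` {(u, v)} \<in> (paths \<times> paths) // path_pair_equiv"
      using * normalisation_in_paths by (intro quotientI) blast
    then show "\<exists>X\<in>(paths \<times> paths) // path_pair_equiv. M = scalar_product_map X"
      using m * scalar_product_map_class by metis
  qed
next
  fix u v p q r s
  assume "normalisation u p q \<and> normalisation v r s"
  then show "scalar_product_tiling p q r s \<in> tame_tilings"
    and "scalar_product_map (path_pair_equiv `` {(u, v)}) = tiling_equiv `` {scalar_product_tiling p q r s}"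
    using scalar_product_tiling_tame scalar_product_map_class by blast+
qed

end
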